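(* Let $n\ge 1$ and suppose that for every $i\in\{1,\dots,n\}$ and $j\in\{A,P\}$, $$y_{j,i}(\theta_i)=q_i\,y_{j,1}(\psi_i(\theta_i))+r_i\qquad(\theta_i\in\Theta_i),$$ where $q_i,r_i\in\mathbb R$, $\psi_i:\Theta_i\to\Theta_1$ is a $C^1$-diffeomorphism, $q_i\psi_i'(\theta_i)>0$ for all $\theta_i\in\Theta_i$, $\mathcal A_i=q_i\mathcal A_1+r_i$, and $(q_1,r_1)=(1,0)$, $\psi_1=\mathrm{id}$. Let $(m_1^*,F_1^* )$ be a saddle point of the one-dimensional problem in dimension $1$. For each $i$ let $m_i^*(\hat\theta_i)$ be the image of the lottery $m_1^*(\psi_i(\hat\theta_i))$ under the map $a\mapsto q_ia+r_i$, let $M^*(\hat\theta)=\bigotimes_{i=1}^n m_i^*(\hat\theta_i)$ be the product lottery, and let $$F^*(\theta_1,\dots,\theta_n)=\int_{\Theta_1}\mathbb I_{\{t\le\theta_1,\ \psi_2^{-1}(t)\le\theta_2,\ \dots,\ \psi_n^{-1}(t)\le\theta_n\}}\,dF_1^*(t).$$ Then $M^*\in\mathcal M$ and $(M^*,F^* )$ is a saddle point of the multidimensional problem: $$V(M^*,F)\ \ge\ V(M^*,F^* )\ \ge\ V(M,F^* )\qquad\text{for all }M\in\mathcal M,\ F\in\mathcal F(\Theta).$$ Consequently separate delegation $M^*$ is robustly optimal, i.e. $\inf_{F\in\mathcal F(\Theta)}V(M^*,F)=\sup_{M\in\mathcal M}\inf_{F\in\mathcal F(\Theta)}V(M,F)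$.
   Context: **One-dimensional problem in dimension 1.** $\Theta_1=[0,1]$; $\mathcal A_1\subset\mathbb R$ is a compact interval; $y_{P,1},y_{A,1}:\Theta_1\to\mathcal A_1$ are continuously differentiable and strictly increasing; the bias $b_1:=y_{A,1}-y_{P,1}$ is monotone (weakly increasing or weakly decreasing) and has at most one zero. A one-dimensional mechanism is a Borel probability kernel $m_1:\Theta_1\to\Delta(\mathcal A_1)$ ($\Delta(\cdot)$ denotes Borel probability distributions); it is incentive compatible if $-\int(a-y_{A,1}(t))^2dm_1(a\mid t)\ge-\int(a-y_{A,1}(t))^2dm_1(a\mid\hat t)$ for all $t,\hat t\in\Theta_1$. $\mathcal F(\Theta_1)$ is the set of CDFs of Borel probability distributions on $\Theta_1$, and $V_1(m_1,F_1):=-\int_{\Theta_1}\int_{\mathcal A_1}(a-y_{P,1}(t))^2\,dm_1(a\mid t)\,dF_1(t)$. A saddle point is a pair $(m_1^*,F_1^* )$ with $m_1^*$ incentive compatible, $F_1^*\in\mathcal F(\Theta_1)$ and $V_1(m_1^*,F_1)\ge V_1(m_1^*,F_1^* )\ge V_1(m_1,F_1^* )$ for all $F_1\in\mathcal F(\Theta_1)$ and all incentive-compatible $m_1$. **Multidimensional problem.** $\Theta=\prod_{i=1}^n\Theta_i=[0,1]^n$ (each $\Theta_i=[0,1]$), $\mathcal A=\prod_{i=1}^n\mathcal A_i$, $y_{j,i}:\Theta_i\to\mathcal A_i$. $\mathcal F(\Theta)$ is the set of joint CDFs of Borel probability distributions on $\Theta$. A mechanism is a Borel probability kernel $M:\Theta\to\Delta(\mathcal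 A)$. For $j\in\{A,P\}$, $u_j(a,\theta)=-\sum_{i=1}^n(a_i-y_{j,i}(\theta_i))^2$ and $U_j^M(\theta,\hat\theta)=\int_{\mathcal A}u_j(a,\theta)\,dM(a\mid\hat\theta)$. $\mathcal M$ is the set of incentive-compatible mechanisms: $U_A^M(\theta,\theta)\ge U_A^M(\theta,\hat\theta)$ for all $\theta,\hat\theta\in\Theta$. $V(M,F):=\int_\Theta U_P^M(\theta,\theta)\,dF(\theta)$. $\mathbb I$ denotes an indicator function. *)

theory Defs
  imports "HOL-Probability.Probability"
begin

datatype player = Agent | Principal

text \<open>Derivatives are taken within the set, so they are one-sided at the endpoints of an interval and
  nothing is required of the values of the function outside the set.\<close>

definition deriv_within :: "(real \<Rightarrow> real) \<Rightarrow> real set \<Rightarrow> real \<Rightarrow> real" where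
  "deriv_within f S x = vector_derivative f (at x within S)"

definition C1_on :: "real set \<Rightarrow> (real \<Rightarrow> real) \<Rightarrow> bool" where
  "C1_on S f \<longleftrightarrow> f differentiable_on S \<and> continuous_on S (deriv_within f S)"

definition C1_diffeomorphism :: "real set \<Rightarrow> real set \<Rightarrow> (real \<Rightarrow> real) \<Rightarrow> bool" where
  "C1_diffeomorphism S T f \<longleftrightarrow> bij_betw f S T \<and> C1_on S f \<and> C1_on T (inv_into S f)"


subsection \<open>The one-dimensional problem\<close>

definition mechanisms1 :: "real set \<Rightarrow> (real \<Rightarrow> real measure) set" where
  "mechanisms1 A = restrict_space borel {0..1} \<rightarrow>\<^sub>M prob_algebra (restrict_space borel A)"

definition IC_mechanisms1 :: "real set \<Rightarrow> (real \<Rightarrow> real) \<Rightarrow> (real \<Rightarrow> real measure) set" where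
  "IC_mechanisms1 A yA = {m \<in> mechanisms1 A. \<forall>t\<in>{0..1}. \<forall>t'\<in>{0..1}.
     - (LINT a|m t. (a - yA t)\<^sup>2) \<ge> - (LINT a|m t'. (a - yA t)\<^sup>2)}"

definition CDFs1 :: "(real \<Rightarrow> real) set" where
  "CDFs1 = {cdf \<mu> |\<mu>. real_distribution \<mu> \<and> measure \<mu> {0..1} = 1}"

definition V1 :: "(real \<Rightarrow> real) \<Rightarrow> (real \<Rightarrow> real measure) \<Rightarrow> (real \<Rightarrow> real) \<Rightarrow> real" where
  "V1 yP m F = - (LINT t:{0..1}|interval_measure F. (LINT a|m t. (a - yP t)\<^sup>2))"

definition saddle_point1 ::
  "real set \<Rightarrow> (real \<Rightarrow> real) \<Rightarrow> (real \<Rightarrow> real) \<Rightarrow> (real \<Rightarrow> real measure) \<Rightarrow> (real \<Rightarrow> real) \<Rightarrow> bool" where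
  "saddle_point1 A yA yP m F \<longleftrightarrow> m \<in> IC_mechanisms1 A yA \<and> F \<in> CDFs1 \<and>
     (\<forall>F'\<in>CDFs1. V1 yP m F' \<ge> V1 yP m F) \<and>
     (\<forall>m'\<in>IC_mechanisms1 A yA. V1 yP m F \<ge> V1 yP m' F)"


subsection \<open>The multidimensional problem\<close>

text \<open>Vectors are functions on \<open>{1..n}\<close> that are \<open>undefined\<close> elsewhere, as in \<^const>\<open>PiM\<close>.\<close>

definition type_space :: "nat \<Rightarrow> (nat \<Rightarrow> real) measure" where
  "type_space n = (\<Pi>\<^sub>M i\<in>{1..n}. restrict_space borel {0..1})"

definition action_space :: "nat \<Rightarrow> (nat \<Rightarrow> real set) \<Rightarrow> (nat \<Rightarrow> real) measure" where
  "action_space n A = (\<Pi>\<^sub>M i\<in>{1..n}. restrict_space borel (A i))"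

definition payoff ::
  "nat \<Rightarrow> (nat \<Rightarrow> real \<Rightarrow> real) \<Rightarrow> (nat \<Rightarrow> real) \<Rightarrow> (nat \<Rightarrow> real) \<Rightarrow> real" where
  "payoff n yj a \<theta> = - (\<Sum>i=1..n. (a i - yj i (\<theta> i))\<^sup>2)"

definition expected_payoff ::
  "nat \<Rightarrow> (nat \<Rightarrow> real \<Rightarrow> real) \<Rightarrow> ((nat \<Rightarrow> real) \<Rightarrow> (nat \<Rightarrow> real) measure) \<Rightarrow>
    (nat \<Rightarrow> real) \<Rightarrow> (nat \<Rightarrow> real) \<Rightarrow> real" where
  "expected_payoff n yj M \<theta> \<theta>' = (LINT a|M \<theta>'. payoff n yj a \<theta>)"

definition mechanisms ::
  "nat \<Rightarrow> (nat \<Rightarrow> real set) \<Rightarrow> ((nat \<Rightarrow> real) \<Rightarrow> (nat \<Rightarrow> real) measure) set" where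
  "mechanisms n A = type_space n \<rightarrow>\<^sub>M prob_algebra (action_space n A)"

definition IC_mechanisms ::
  "nat \<Rightarrow> (nat \<Rightarrow> real set) \<Rightarrow> (nat \<Rightarrow> real \<Rightarrow> real) \<Rightarrow>
    ((nat \<Rightarrow> real) \<Rightarrow> (nat \<Rightarrow> real) measure) set" where
  "IC_mechanisms n A yA = {M \<in> mechanisms n A.
     \<forall>\<theta>\<in>space (type_space n). \<forall>\<theta>'\<in>space (type_space n).
       expected_payoff n yA M \<theta> \<theta> \<ge> expected_payoff n yA M \<theta> \<theta>'}"

text \<open>A joint CDF is a function on all of \<open>\<real>\<^sup>n\<close>; it depends only on the coordinates in \<open>{1..n}\<close>.\<close>

definition joint_cdf :: "nat \<Rightarrow> (nat \<Rightarrow> real) measure \<Rightarrow> (nat \<Rightarrow> real) \<Rightarrow> real" where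
  "joint_cdf n \<mu> \<theta> = measure \<mu> {x \<in> space \<mu>. \<forall>i\<in>{1..n}. x i \<le> \<theta> i}"

definition CDFs :: "nat \<Rightarrow> ((nat \<Rightarrow> real) \<Rightarrow> real) set" where
  "CDFs n = joint_cdf n ` space (prob_algebra (type_space n))"

text \<open>Integration against a joint CDF is integration against the distribution on the type space that
  has it as its CDF; it is unique because the lower orthants form a generating
  intersection-stable family.\<close>

definition distribution_of :: "nat \<Rightarrow> ((nat \<Rightarrow> real) \<Rightarrow> real) \<Rightarrow> (nat \<Rightarrow> real) measure" where
  "distribution_of n F = (THE \<mu>. \<mu> \<in> space (prob_algebra (type_space n)) \<and> joint_cdf n \<mu> = F)"

definition V ::
  "nat \<Rightarrow> (nat \<Rightarrow> real \<Rightarrow> real) \<Rightarrow> ((nat \<Rightarrow> real) \<Rightarrow> (nat \<Rightarrow> real) measure) \<Rightarrow>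
    ((nat \<Rightarrow> real) \<Rightarrow> real) \<Rightarrow> real" where
  "V n yP M F = (LINT \<theta>|distribution_of n F. expected_payoff n yP M \<theta> \<theta>)"


subsection \<open>Separate delegation\<close>

definition component_mechanism ::
  "(nat \<Rightarrow> real set) \<Rightarrow> (nat \<Rightarrow> real) \<Rightarrow> (nat \<Rightarrow> real) \<Rightarrow> (nat \<Rightarrow> real \<Rightarrow> real) \<Rightarrow>
    (real \<Rightarrow> real measure) \<Rightarrow> nat \<Rightarrow> real \<Rightarrow> real measure" where
  "component_mechanism A q r \<psi> m1 i t =
     distr (m1 (\<psi> i t)) (restrict_space borel (A i)) (\<lambda>a. q i * a + r i)"

definition separate_delegation ::
  "nat \<Rightarrow> (nat \<Rightarrow> real set) \<Rightarrow> (nat \<Rightarrow> real) \<Rightarrow> (nat \<Rightarrow> real) \<Rightarrow> (nat \<Rightarrow> real \<Rightarrow> real) \<Rightarrow>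
    (real \<Rightarrow> real measure) \<Rightarrow> (nat \<Rightarrow> real) \<Rightarrow> (nat \<Rightarrow> real) measure" where
  "separate_delegation n A q r \<psi> m1 \<theta> =
     (\<Pi>\<^sub>M i\<in>{1..n}. component_mechanism A q r \<psi> m1 i (\<theta> i))"

definition coupled_CDF ::
  "nat \<Rightarrow> (nat \<Rightarrow> real \<Rightarrow> real) \<Rightarrow> (real \<Rightarrow> real) \<Rightarrow> (nat \<Rightarrow> real) \<Rightarrow> real" where
  "coupled_CDF n \<psi> F1 \<theta> = (LINT t:{0..1}|interval_measure F1.
     indicat_real {s. s \<le> \<theta> 1 \<and> (\<forall>i\<in>{2..n}. inv_into {0..1} (\<psi> i) s \<le> \<theta> i)} t)"

end

theory Submission
  imports Defs
begin

text \<open>The map \<open>a \<mapsto> q i * a + r i\<close> together with \<open>\<psi> i\<close> turns dimension \<open>i\<close> into a copy of dimension 1 whose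
  quadratic payoffs are scaled by \<open>(q i)\<^sup>2\<close>. Under separate delegation the payoff is therefore the
  weighted sum of one-dimensional payoffs, and for every joint distribution each marginal gives at
  least the one-dimensional saddle value.

  Conversely, the worst case \<open>F\<^sub>s\<close> is carried by the curve along which every \<open>\<psi> i (\<theta> i)\<close> equals a common
  \<open>t\<close>. There any mechanism pays both players the same as the one-dimensional mechanism that draws a
  coordinate \<open>i\<close> with probability proportional to \<open>(q i)\<^sup>2\<close> and implements the rescaled action
  \<open>(a i - r i) / q i\<close>; it inherits incentive compatibility, so it cannot beat the saddle value either.\<close>

section \<open>Kernels of lotteries and their quadratic losses\<close>

abbreviation unit_borel :: "real measure" where
  "unit_borel \<equiv> restrict_space borel {0..1}"

definition quadratic_loss :: "real measure \<Rightarrow> real \<Rightarrow> real" where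
  "quadratic_loss \<mu> c = (LINT a|\<mu>. (a - c)\<^sup>2)"

text \<open>Boxes form an intersection-stable generator of the product sigma-algebra, so a family of
  probability measures is a kernel once the mass of each box is measurable. That mass is a finite
  product of the masses of its sides. This is what makes separate delegation a mechanism.\<close>

lemma measurable_PiM_prob_algebra:
  assumes I: "finite I" and K: "\<And>i. i \<in> I \<Longrightarrow> K i \<in> N \<rightarrow>\<^sub>M prob_algebra (M i)"
  shows "(\<lambda>x. \<Pi>\<^sub>M i\<in>I. K i x) \<in> N \<rightarrow>\<^sub>M prob_algebra (Pi\<^sub>M I M)"
proof (rule measurable_prob_algebra_generated[OF sets_PiM Int_stable_prod_algebra
      prod_algebra_sets_into_space])
  have K_space: "prob_space (K i x)" "sets (K i x) = sets (M i)" if "i \<in> I" "x \<in> space N" for i x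
    using measurable_space[OF K[OF that(1)] that(2)] by (auto simp: space_prob_algebra)
  show "prob_space (\<Pi>\<^sub>M i\<in>I. K i x)" if "x \<in> space N" for x
    using K_space that by (intro prob_space_PiM) auto
  show "sets (\<Pi>\<^sub>M i\<in>I. K i x) = sets (Pi\<^sub>M I M)" if "x \<in> space N" for x
    using K_space that by (intro sets_PiM_cong) auto
  fix B assume "B \<in> prod_algebra I M"
  then obtain X where B: "B = Pi\<^sub>E I X" and X: "\<And>i. i \<in> I \<Longrightarrow> X i \<in> sets (M i)"
    unfolding prod_algebra_eq_finite[OF I] by auto
  have "emeasure (\<Pi>\<^sub>M i\<in>I. K i x) B = (\<Prod>i\<in>I. emeasure (K i x) (X i))" if "x \<in> space N" for x
  proof -
    have "prod_emb I (\<lambda>i. K i x) I (Pi\<^sub>E I X) = B"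
      unfolding B using X K_space that
      by (intro prod_emb_PiE_same_index) (metis sets.sets_into_space)
    then show ?thesis
      using emeasure_PiM_emb[of I "\<lambda>i. K i x" I X] K_space that X I by auto
  qed
  moreover have "(\<lambda>x. \<Prod>i\<in>I. emeasure (K i x) (X i)) \<in> borel_measurable N"
    using K X by (intro borel_measurable_prod_ennreal)
      (auto intro!: measurable_compose[OF measurable_prob_algebraD measurable_emeasure_subprob_algebra])
  ultimately show "(\<lambda>x. emeasure (\<Pi>\<^sub>M i\<in>I. K i x) B) \<in> borel_measurable N"
    by (subst measurable_cong) auto
qed

text \<open>The integrand depends on \<open>x\<close> as well as on the drawn point. Pushing
  \<open>L x\<close> forward along \<open>Pair x\<close> places it on the slice over
  \<open>x\<close> and gives a kernel into \<open>N \<Otimes>\<^sub>M B\<close>, against which the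
  single function \<open>f\<close> on the product is integrated.\<close>

lemma borel_measurable_integral_kernel:
  fixes f :: "'a \<Rightarrow> 'b \<Rightarrow> real"
  assumes f: "(\<lambda>(x, y). f x y) \<in> borel_measurable (N \<Otimes>\<^sub>M B)" and L: "L \<in> N \<rightarrow>\<^sub>M prob_algebra B"
  shows "(\<lambda>x. LINT y|L x. f x y) \<in> borel_measurable N"
proof -
  have "(\<lambda>x. distr (L x) (N \<Otimes>\<^sub>M B) (Pair x)) \<in> N \<rightarrow>\<^sub>M prob_algebra (N \<Otimes>\<^sub>M B)"
    by (rule measurable_distr_prob_space2[OF L]) simp
  then have "(\<lambda>x. LINT z|distr (L x) (N \<Otimes>\<^sub>M B) (Pair x). (\<lambda>(x, y). f x y) z) \<in> borel_measurable N"
    by (rule measurable_compose[OF measurable_prob_algebraD integral_measurable_subprob_algebra[OF f]])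
  moreover have "(LINT z|distr (L x) (N \<Otimes>\<^sub>M B) (Pair x). (\<lambda>(x, y). f x y) z) = (LINT y|L x. f x y)"
    if x: "x \<in> space N" for x
  proof -
    have "sets (L x) = sets B" using measurable_space[OF L x] by (simp add: space_prob_algebra)
    then have "Pair x \<in> L x \<rightarrow>\<^sub>M N \<Otimes>\<^sub>M B"
      using measurable_Pair1'[OF x, of B] by (simp cong: measurable_cong_sets)
    then show ?thesis by (subst integral_distr[OF _ f]) auto
  qed
  ultimately show ?thesis by (subst (asm) measurable_cong) auto
qed

lemma borel_measurable_quadratic_loss:
  assumes m: "m \<in> N \<rightarrow>\<^sub>M prob_algebra (restrict_space borel S)" and c[measurable]: "c \<in> borel_measurable N"
  shows "(\<lambda>x. quadratic_loss (m x) (c x)) \<in> borel_measurable N"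
  unfolding quadratic_loss_def
proof (rule borel_measurable_integral_kernel[OF _ m])
  have [measurable]: "(\<lambda>a. a) \<in> restrict_space borel S \<rightarrow>\<^sub>M borel"
    by (rule measurable_restrict_space1) simp
  have [measurable]: "snd \<in> N \<Otimes>\<^sub>M restrict_space borel S \<rightarrow>\<^sub>M borel"
    by (rule measurable_compose[OF measurable_snd]) measurable
  show "(\<lambda>(x, a). (a - c x)\<^sup>2) \<in> borel_measurable (N \<Otimes>\<^sub>M restrict_space borel S)"
    by measurable
qed

lemma integrable_bounded:
  fixes f :: "'a \<Rightarrow> real"
  assumes "prob_space M" "f \<in> borel_measurable M" "\<And>x. x \<in> space M \<Longrightarrow> \<bar>f x\<bar> \<le> B"
  shows "integrable M f"
proof -
  interpret prob_space M by fact
  show ?thesis using assms by (intro integrable_const_bound[where B=B] AE_I2) auto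
qed

lemma square_diff_bound:
  fixes a c :: real
  assumes "\<bar>a\<bar> \<le> K" "\<bar>c\<bar> \<le> L"
  shows "\<bar>(a - c)\<^sup>2\<bar> \<le> (K + L)\<^sup>2"
  using assms by (auto simp: abs_le_square_iff[symmetric])

lemma quadratic_loss_bounded:
  assumes "prob_space \<mu>" "sets \<mu> = sets (restrict_space borel S)" "\<And>a. a \<in> S \<Longrightarrow> \<bar>a\<bar> \<le> K" "\<bar>c\<bar> \<le> L"
  shows "\<bar>quadratic_loss \<mu> c\<bar> \<le> (K + L)\<^sup>2"
proof -
  interpret prob_space \<mu> by fact
  have sp: "space \<mu> = S" using sets_eq_imp_space_eq[OF assms(2)] by (simp add: space_restrict_space)
  have b: "\<bar>(a - c)\<^sup>2\<bar> \<le> (K + L)\<^sup>2" if "a \<in> space \<mu>" for a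
    using square_diff_bound assms(3,4) that sp by auto
  have [measurable]: "(\<lambda>a. a) \<in> \<mu> \<rightarrow>\<^sub>M borel"
    using assms(2) by (simp cong: measurable_cong_sets add: measurable_restrict_space1)
  have "integrable \<mu> (\<lambda>a. (a - c)\<^sup>2)"
    by (rule integrable_bounded[OF assms(1) _ b]) auto
  then have "(LINT a|\<mu>. (a - c)\<^sup>2) \<le> (LINT a|\<mu>. (K + L)\<^sup>2)"
    using b by (intro integral_mono) auto
  moreover have "0 \<le> (LINT a|\<mu>. (a - c)\<^sup>2)" by simp
  ultimately show ?thesis by (simp add: quadratic_loss_def prob_space)
qed


subsection \<open>Distributions and their CDFs\<close>

text \<open>Both sides are real distributions with the same CDF. The one-dimensional value, which
  integrates against \<open>interval_measure F\<close>, thereby becomes an integral against the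
  distribution itself.\<close>

lemma interval_measure_cdf:
  assumes "real_distribution \<mu>"
  shows "interval_measure (cdf \<mu>) = \<mu>"
proof (rule cdf_unique)
  interpret real_distribution \<mu> by fact
  show "real_distribution (interval_measure (cdf \<mu>))"
    by (intro real_distribution_interval_measure cdf_nondecreasing cdf_is_right_cont
        cdf_lim_at_bot cdf_lim_at_top_prob)
  show "cdf (interval_measure (cdf \<mu>)) = cdf \<mu>"
    by (intro cdf_interval_measure cdf_nondecreasing cdf_is_right_cont cdf_lim_at_bot)
qed fact

text \<open>Types live on the subspace \<open>unit_borel\<close>, whereas \<open>cdf\<close> belongs
  to measures on the whole line; the push-forward along the inclusion bridges the two.\<close>

abbreviation unit_cdf :: "real measure \<Rightarrow> real \<Rightarrow> real" where
  "unit_cdf \<nu> \<equiv> cdf (distr \<nu> borel (\<lambda>x. x))"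

lemma
  assumes \<nu>: "\<nu> \<in> space (prob_algebra unit_borel)"
  shows real_distribution_distr_unit: "real_distribution (distr \<nu> borel (\<lambda>x. x))"
    and restrict_distr_unit: "restrict_space (distr \<nu> borel (\<lambda>x. x)) {0..1} = \<nu>"
    and measure_distr_unit: "measure (distr \<nu> borel (\<lambda>x. x)) {0..1} = 1"
proof -
  interpret prob_space \<nu> using \<nu> by (simp add: space_prob_algebra)
  have s: "sets \<nu> = sets unit_borel" using \<nu> by (simp add: space_prob_algebra)
  have sp: "space \<nu> = {0..1}" using sets_eq_imp_space_eq[OF s] by (simp add: space_restrict_space)
  have [measurable]: "(\<lambda>x. x) \<in> \<nu> \<rightarrow>\<^sub>M borel"
    using s by (simp cong: measurable_cong_sets add: measurable_restrict_space1)
  show "real_distribution (distr \<nu> borel (\<lambda>x. x))"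
    by (intro real_distribution_distr) measurable
  have "(\<lambda>x. x) -` {0..1} \<inter> space \<nu> = space \<nu>" using sp by auto
  then show "measure (distr \<nu> borel (\<lambda>x. x)) {0..1} = 1"
    by (simp add: measure_distr prob_space)
  show "restrict_space (distr \<nu> borel (\<lambda>x. x)) {0..1} = \<nu>"
  proof (rule measure_eqI)
    show eq: "sets (restrict_space (distr \<nu> borel (\<lambda>x. x)) {0..1}) = sets \<nu>"
      unfolding s by (intro restrict_space_sets_cong) auto
    fix X assume "X \<in> sets (restrict_space (distr \<nu> borel (\<lambda>x. x)) {0..1})"
    then have X: "X \<in> sets borel" "X \<subseteq> {0..1}"
      by (auto simp: sets_restrict_space_iff)
    then have "(\<lambda>x. x) -` X \<inter> space \<nu> = X" using sp by auto
    with X show "emeasure (restrict_space (distr \<nu> borel (\<lambda>x. x)) {0..1}) X = emeasure \<nu> X"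
      by (simp add: emeasure_restrict_space emeasure_distr)
  qed
qed

lemma set_integral_unit_cdf:
  fixes g :: "real \<Rightarrow> real"
  assumes \<nu>: "\<nu> \<in> space (prob_algebra unit_borel)"
  shows "(LINT t:{0..1}|interval_measure (unit_cdf \<nu>). g t) = (LINT t|\<nu>. g t)"
  unfolding set_lebesgue_integral_def interval_measure_cdf[OF real_distribution_distr_unit[OF \<nu>]]
  using integral_restrict_space[of "{0..1}" "distr \<nu> borel (\<lambda>x. x)" g] restrict_distr_unit[OF \<nu>]
  by simp

text \<open>From here on a one-dimensional prior can be handled as a probability measure on the type
  interval: restriction to the interval and push-forward along the inclusion undo each
  other.\<close>

lemma CDFs1_eq: "CDFs1 = unit_cdf ` space (prob_algebra unit_borel)"
proof (intro equalityI subsetI)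
  fix F assume "F \<in> CDFs1"
  then obtain \<mu> where F: "F = cdf \<mu>" and \<mu>: "real_distribution \<mu>" "measure \<mu> {0..1} = 1"
    by (auto simp: CDFs1_def)
  interpret real_distribution \<mu> by fact
  let ?\<nu> = "restrict_space \<mu> {0..1}"
  have e1: "emeasure \<mu> {0..1} = 1" using \<mu>(2) by (simp add: emeasure_eq_measure)
  have s: "sets ?\<nu> = sets unit_borel" by (intro restrict_space_sets_cong) auto
  have \<nu>: "?\<nu> \<in> space (prob_algebra unit_borel)"
    using s e1 by (auto simp: space_prob_algebra emeasure_restrict_space space_restrict_space intro!: prob_spaceI)
  have "distr ?\<nu> borel (\<lambda>x. x) = \<mu>"
  proof (rule measure_eqI)
    fix X assume "X \<in> sets (distr ?\<nu> borel (\<lambda>x. x))"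
    then have X: "X \<in> sets \<mu>" by simp
    \<comment> \<open>The interval has full mass, so cutting \<open>X\<close> down to it costs
      nothing.\<close>
    have AE: "AE x in \<mu>. x \<in> {0..1}" using \<mu>(2) prob_eq_1[of "{0..1}"] by simp
    have "emeasure (distr ?\<nu> borel (\<lambda>x. x)) X = emeasure ?\<nu> (X \<inter> {0..1})"
      using X by (subst emeasure_distr) (auto simp: space_restrict_space measurable_restrict_space1)
    also have "\<dots> = emeasure \<mu> (X \<inter> {0..1})"
      using X by (subst emeasure_restrict_space) auto
    also have "\<dots> = emeasure \<mu> X"
      using AE X by (intro emeasure_eq_AE) auto
    finally show "emeasure (distr ?\<nu> borel (\<lambda>x. x)) X = emeasure \<mu> X" .
  qed simp
  then have "F = unit_cdf ?\<nu>" using F by simp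
  then show "F \<in> unit_cdf ` space (prob_algebra unit_borel)" using \<nu> by (rule image_eqI)
next
  fix F assume "F \<in> unit_cdf ` space (prob_algebra unit_borel)"
  then show "F \<in> CDFs1"
    using real_distribution_distr_unit measure_distr_unit by (force simp: CDFs1_def)
qed

lemma space_type_space: "space (type_space n) = (\<Pi>\<^sub>E i\<in>{1..n}. {0..1})"
  by (simp add: type_space_def space_PiM space_restrict_space)

lemma measurable_type_space_component:
  "i \<in> {1..n} \<Longrightarrow> (\<lambda>\<theta>. \<theta> i) \<in> type_space n \<rightarrow>\<^sub>M unit_borel"
  unfolding type_space_def by (rule measurable_component_singleton)

text \<open>For the harder inclusion it suffices that the identity is measurable from the
  sigma-algebra generated by the orthants into the product, which can be tested one coordinate at a
  time.\<close>

lemma sets_type_space_orthants: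
  "sets (type_space n) =
    sigma_sets (space (type_space n)) (range (\<lambda>c. {x \<in> space (type_space n). \<forall>i\<in>{1..n}. x i \<le> c i}))"
  (is "_ = sigma_sets ?\<Omega> ?G")
proof
  have G: "?G \<subseteq> Pow ?\<Omega>" by auto
  have sp: "space (sigma ?\<Omega> ?G) = ?\<Omega>" by (rule space_measure_of[OF G])
  have comp: "(\<lambda>w. w i) \<in> sigma ?\<Omega> ?G \<rightarrow>\<^sub>M unit_borel" if i: "i \<in> {1..n}" for i
  proof (rule measurable_restrict_space2)
    show "(\<lambda>w. w i) \<in> space (sigma ?\<Omega> ?G) \<rightarrow> {0..1}"
      unfolding sp using i by (auto simp: space_type_space PiE_iff)
    show "(\<lambda>w. w i) \<in> borel_measurable (sigma ?\<Omega> ?G)"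
      unfolding borel_measurable_iff_le
    proof
      fix a
      \<comment> \<open>A bound on one coordinate alone is an orthant: every other bound is set to
        1, the upper end of the type interval, where it does not bind.\<close>
      have "{w \<in> space (sigma ?\<Omega> ?G). w i \<le> a} =
        {x \<in> ?\<Omega>. \<forall>k\<in>{1..n}. x k \<le> (\<lambda>k. if k = i then a else 1) k}"
        unfolding sp using i by (auto simp: space_type_space PiE_iff)
      also have "\<dots> \<in> ?G" by (rule rangeI)
      finally show "{w \<in> space (sigma ?\<Omega> ?G). w i \<le> a} \<in> sets (sigma ?\<Omega> ?G)"
        by (simp only: sets_measure_of[OF G] sigma_sets.Basic)
    qed
  qed
  have id: "(\<lambda>w. w) \<in> sigma ?\<Omega> ?G \<rightarrow>\<^sub>M type_space n"
  proof -
    have "(\<lambda>w i. w i) \<in> sigma ?\<Omega> ?G \<rightarrow>\<^sub>M (\<Pi>\<^sub>M i\<in>{1..n}. unit_borel)"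
    proof (rule measurable_PiM_single'[OF comp])
      show "(\<lambda>w i. w i) \<in> space (sigma ?\<Omega> ?G) \<rightarrow> (\<Pi>\<^sub>E i\<in>{1..n}. space unit_borel)"
        unfolding sp by (simp add: space_type_space space_restrict_space)
    qed
    then show ?thesis by (simp add: type_space_def)
  qed
  have "X \<in> sigma_sets ?\<Omega> ?G" if "X \<in> sets (type_space n)" for X
    using measurable_sets[OF id that] sets.Int_space_eq2[OF that] by (simp only: sp sets_measure_of[OF G] vimage_ident)
  then show "sets (type_space n) \<subseteq> sigma_sets ?\<Omega> ?G"
    by (rule subsetI)
  have "{x \<in> ?\<Omega>. \<forall>i\<in>{1..n}. x i \<le> c i} \<in> sets (type_space n)" for c
  proof -
    have "(\<lambda>x. x i) \<in> borel_measurable (type_space n)" if "i \<in> {1..n}" for i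
      using measurable_type_space_component[OF that] by (simp add: measurable_restrict_space2_iff)
    then have "{x \<in> ?\<Omega>. x i \<le> c i} \<in> sets (type_space n)" if "i \<in> {1..n}" for i
      using that unfolding borel_measurable_iff_le by blast
    then show ?thesis by (rule sets.sets_Collect_finite_All) auto
  qed
  then show "sigma_sets ?\<Omega> ?G \<subseteq> sets (type_space n)"
    by (intro sets.sigma_sets_subset) auto
qed

text \<open>Orthants generate the sigma-algebra and are closed under intersection, the new corner
  being the coordinatewise minimum, so equal masses on them force equal measures. Hence the definite
  description in \<open>distribution_of\<close> is well defined on \<open>CDFs n\<close>.\<close>

lemma joint_cdf_unique:
  assumes \<mu>: "\<mu> \<in> space (prob_algebra (type_space n))" and \<nu>: "\<nu> \<in> space (prob_algebra (type_space n))"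
    and eq: "joint_cdf n \<mu> = joint_cdf n \<nu>"
  shows "\<mu> = \<nu>"
proof -
  let ?\<Omega> = "space (type_space n)"
  let ?O = "\<lambda>c. {x \<in> ?\<Omega>. \<forall>i\<in>{1..n}. x i \<le> c i}"
  interpret \<mu>: prob_space \<mu> using \<mu> by (simp add: space_prob_algebra)
  interpret \<nu>: prob_space \<nu> using \<nu> by (simp add: space_prob_algebra)
  have s: "sets \<mu> = sets (type_space n)" "sets \<nu> = sets (type_space n)"
    using \<mu> \<nu> by (simp_all add: space_prob_algebra)
  note sp = s[THEN sets_eq_imp_space_eq]
  \<comment> \<open>The whole space is itself an orthant, so a constant sequence is an exhaustion by
    generators of finite measure.\<close>
  have \<Omega>: "?O (\<lambda>_. 1) = ?\<Omega>" unfolding space_type_space by (auto dest: PiE_mem)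
  show ?thesis
  proof (rule measure_eqI_generator_eq[of "range ?O" ?\<Omega> _ _ "\<lambda>_. ?\<Omega>"])
    show "Int_stable (range ?O)"
    proof (rule Int_stableI)
      fix a b assume "a \<in> range ?O" "b \<in> range ?O"
      then obtain c d where "a = ?O c" "b = ?O d" by auto
      then have "a \<inter> b = ?O (\<lambda>i. min (c i) (d i))" by auto
      then show "a \<inter> b \<in> range ?O" by (rule range_eqI[where x="\<lambda>i. min (c i) (d i)"])
    qed
    show "emeasure \<mu> X = emeasure \<nu> X" if "X \<in> range ?O" for X
    proof -
      from that obtain c where "X = ?O c" by auto
      then show ?thesis
        using fun_cong[OF eq, of c] sp by (simp add: joint_cdf_def \<mu>.emeasure_eq_measure \<nu>.emeasure_eq_measure)
    qed
    have "?\<Omega> \<in> range ?O" by (rule range_eqI[where x="\<lambda>_. 1"]) (rule \<Omega>[symmetric])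
    then show "range (\<lambda>_::nat. ?\<Omega>) \<subseteq> range ?O" by auto
    show "sets \<mu> = sigma_sets ?\<Omega> (range ?O)" "sets \<nu> = sigma_sets ?\<Omega> (range ?O)"
      unfolding s by (rule sets_type_space_orthants)+
  qed auto
qed

lemma distribution_of_joint_cdf:
  "\<mu> \<in> space (prob_algebra (type_space n)) \<Longrightarrow> distribution_of n (joint_cdf n \<mu>) = \<mu>"
  unfolding distribution_of_def by (rule the_equality) (auto intro: joint_cdf_unique)

lemma V_joint_cdf:
  "\<mu> \<in> space (prob_algebra (type_space n)) \<Longrightarrow>
    V n yP M (joint_cdf n \<mu>) = (LINT \<theta>|\<mu>. expected_payoff n yP M \<theta> \<theta>)"
  by (simp add: V_def distribution_of_joint_cdf)

lemma V1_unit_cdf: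
  "\<nu> \<in> space (prob_algebra unit_borel) \<Longrightarrow>
    V1 yP m (unit_cdf \<nu>) = - (LINT t|\<nu>. quadratic_loss (m t) (yP t))"
  by (simp add: V1_def set_integral_unit_cdf quadratic_loss_def)

lemma IC_mechanisms1_iff:
  "m \<in> IC_mechanisms1 S yA \<longleftrightarrow> m \<in> mechanisms1 S \<and>
    (\<forall>t\<in>{0..1}. \<forall>t'\<in>{0..1}. quadratic_loss (m t) (yA t) \<le> quadratic_loss (m t') (yA t))"
  by (auto simp: IC_mechanisms1_def quadratic_loss_def)


subsection \<open>Dimensions that are rescaled copies of dimension 1\<close>

text \<open>Bijectivity and continuity in both directions make each \<open>\<psi> i\<close> a Borel
  isomorphism of the type interval; \<open>q i \<noteq> 0\<close> makes the affine map from
  \<open>A 1\<close> onto \<open>A i\<close> invertible.\<close>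

locale rescaled_copies =
  fixes n :: nat and A :: "nat \<Rightarrow> real set" and y :: "player \<Rightarrow> nat \<Rightarrow> real \<Rightarrow> real"
    and q r :: "nat \<Rightarrow> real" and \<psi> :: "nat \<Rightarrow> real \<Rightarrow> real"
  assumes n: "n \<ge> 1"
    and compact_A: "compact (A 1)"
    and y1_cont: "\<And>j. continuous_on {0..1} (y j 1)"
    and y_eq: "\<And>i j t. i \<in> {1..n} \<Longrightarrow> t \<in> {0..1} \<Longrightarrow> y j i t = q i * y j 1 (\<psi> i t) + r i"
    and \<psi>_bij: "\<And>i. i \<in> {1..n} \<Longrightarrow> bij_betw (\<psi> i) {0..1} {0..1}"
    and \<psi>_cont: "\<And>i. i \<in> {1..n} \<Longrightarrow> continuous_on {0..1} (\<psi> i)"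
    and \<psi>_inv_cont: "\<And>i. i \<in> {1..n} \<Longrightarrow> continuous_on {0..1} (inv_into {0..1} (\<psi> i))"
    and q_nonzero: "\<And>i. i \<in> {1..n} \<Longrightarrow> q i \<noteq> 0"
    and A_eq: "\<And>i. i \<in> {1..n} \<Longrightarrow> A i = (\<lambda>a. q i * a + r i) ` A 1"
    and \<psi>_1: "\<And>t. t \<in> {0..1} \<Longrightarrow> \<psi> 1 t = t"
begin

definition \<phi> :: "nat \<Rightarrow> real \<Rightarrow> real" where
  "\<phi> i = inv_into {0..1} (\<psi> i)"

text \<open>The type profiles at which all \<open>\<psi> i (\<theta> i)\<close> agree, parametrised
  by the common value. The restricted lambda keeps the profile \<open>undefined\<close> off
  \<open>{1..n}\<close>, as the product space demands.\<close>

definition curve :: "real \<Rightarrow> nat \<Rightarrow> real" where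
  "curve t = (\<lambda>i\<in>{1..n}. \<phi> i t)"

lemma \<psi>_unit: "i \<in> {1..n} \<Longrightarrow> t \<in> {0..1} \<Longrightarrow> \<psi> i t \<in> {0..1}"
  using bij_betwE[OF \<psi>_bij] by blast

lemma \<phi>_unit: "i \<in> {1..n} \<Longrightarrow> t \<in> {0..1} \<Longrightarrow> \<phi> i t \<in> {0..1}"
  unfolding \<phi>_def using \<psi>_bij by (intro inv_into_into) (auto simp: bij_betw_def)

lemma \<psi>_\<phi>: "i \<in> {1..n} \<Longrightarrow> t \<in> {0..1} \<Longrightarrow> \<psi> i (\<phi> i t) = t"
  unfolding \<phi>_def using \<psi>_bij by (intro f_inv_into_f) (auto simp: bij_betw_def)

lemma \<phi>_1: "t \<in> {0..1} \<Longrightarrow> \<phi> 1 t = t"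
  using \<psi>_\<phi>[of 1 t] \<psi>_1[of "\<phi> 1 t"] \<phi>_unit[of 1 t] n by auto

lemma \<psi>_measurable: "i \<in> {1..n} \<Longrightarrow> \<psi> i \<in> unit_borel \<rightarrow>\<^sub>M unit_borel"
  using \<psi>_cont \<psi>_unit
  by (intro measurable_restrict_space2 borel_measurable_continuous_on_restrict)
    (auto simp: space_restrict_space)

lemma \<phi>_measurable: "i \<in> {1..n} \<Longrightarrow> \<phi> i \<in> unit_borel \<rightarrow>\<^sub>M unit_borel"
  using \<psi>_inv_cont \<phi>_unit
  by (intro measurable_restrict_space2 borel_measurable_continuous_on_restrict)
    (auto simp: space_restrict_space \<phi>_def)

lemma y1_measurable: "y j 1 \<in> borel_measurable unit_borel"
  by (intro borel_measurable_continuous_on_restrict y1_cont)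

lemma curve_space: "t \<in> {0..1} \<Longrightarrow> curve t \<in> space (type_space n)"
  using \<phi>_unit by (auto simp: curve_def space_type_space)

lemma curve_measurable: "curve \<in> unit_borel \<rightarrow>\<^sub>M type_space n"
  unfolding curve_def[abs_def] type_space_def by (intro measurable_restrict \<phi>_measurable)

lemma A1_bounded: obtains K where "\<And>a. a \<in> A 1 \<Longrightarrow> \<bar>a\<bar> \<le> K"
  using compact_imp_bounded[OF compact_A] by (auto simp: bounded_iff)

lemma y1_bounded: obtains L where "\<And>t. t \<in> {0..1} \<Longrightarrow> \<bar>y j 1 t\<bar> \<le> L"
proof -
  have "bounded (y j 1 ` {0..1})"
    by (intro compact_imp_bounded compact_continuous_image y1_cont compact_Icc)
  then obtain L where "\<forall>t\<in>{0..1}. \<bar>y j 1 t\<bar> \<le> L" unfolding bounded_iff by auto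
  then show ?thesis using that by blast
qed

lemma A_rescale: "i \<in> {1..n} \<Longrightarrow> a \<in> A 1 \<Longrightarrow> q i * a + r i \<in> A i"
  by (subst A_eq) auto

lemma A_unscale: "i \<in> {1..n} \<Longrightarrow> a \<in> A i \<Longrightarrow> (a - r i) / q i \<in> A 1"
  using q_nonzero by (subst (asm) A_eq) auto

lemma rescale_measurable:
  "i \<in> {1..n} \<Longrightarrow> (\<lambda>a. q i * a + r i) \<in> restrict_space borel (A 1) \<rightarrow>\<^sub>M restrict_space borel (A i)"
  using A_rescale
  by (intro measurable_restrict_space3) (auto intro!: borel_measurable_continuous_onI continuous_intros)

lemma unscale_measurable:
  "i \<in> {1..n} \<Longrightarrow> (\<lambda>a. (a - r i) / q i) \<in> restrict_space borel (A i) \<rightarrow>\<^sub>M restrict_space borel (A 1)"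
  using A_unscale by (intro measurable_restrict_space3) (auto simp: divide_inverse)

text \<open>The bliss points of both players in dimension \<open>i\<close> arise from dimension 1 by
  the same affine map, so unscaling the action pulls out a common factor \<open>q i\<close> before
  squaring.\<close>

lemma payoff_rescaled:
  assumes "\<theta> \<in> space (type_space n)"
  shows "payoff n (y j) a \<theta> =
    - (\<Sum>i=1..n. (q i)\<^sup>2 * ((a i - r i) / q i - y j 1 (\<psi> i (\<theta> i)))\<^sup>2)"
  unfolding payoff_def
proof (intro arg_cong[where f=uminus] sum.cong refl)
  fix i assume i: "i \<in> {1..n}"
  then have "a i - y j i (\<theta> i) = q i * ((a i - r i) / q i - y j 1 (\<psi> i (\<theta> i)))"
    using y_eq[OF i, of "\<theta> i" j] assms q_nonzero[OF i] by (auto simp: space_type_space PiE_iff field_simps)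
  then show "(a i - y j i (\<theta> i))\<^sup>2 = (q i)\<^sup>2 * ((a i - r i) / q i - y j 1 (\<psi> i (\<theta> i)))\<^sup>2"
    by (simp add: power_mult_distrib)
qed

section \<open>Separate delegation built from a one-dimensional mechanism\<close>

context
  fixes m assumes m: "m \<in> mechanisms1 (A 1)"
begin

lemma mechanism1_space:
  assumes "t \<in> {0..1}"
  shows "prob_space (m t)" "sets (m t) = sets (restrict_space borel (A 1))"
  using measurable_space[OF m[unfolded mechanisms1_def], of t] assms
  by (auto simp: space_prob_algebra space_restrict_space)

lemma component_mechanism_kernel:
  assumes i: "i \<in> {1..n}"
  shows "component_mechanism A q r \<psi> m i \<in> unit_borel \<rightarrow>\<^sub>M prob_algebra (restrict_space borel (A i))"
  unfolding component_mechanism_def[abs_def]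
  by (rule measurable_compose[OF measurable_compose[OF \<psi>_measurable[OF i] m[unfolded mechanisms1_def]]
        measurable_distr_prob_space[OF rescale_measurable[OF i]]])

lemma separate_delegation_mechanism: "separate_delegation n A q r \<psi> m \<in> mechanisms n A"
  unfolding separate_delegation_def[abs_def] mechanisms_def action_space_def
  by (intro measurable_PiM_prob_algebra measurable_compose[OF measurable_type_space_component
        component_mechanism_kernel]) auto

text \<open>The payoff is a sum over coordinates, so only the marginals of the product lottery
  matter. The marginal in dimension \<open>i\<close> is the rescaled lottery of \<open>m\<close> at
  \<open>\<psi> i (\<theta>' i)\<close>, and the unscaling in the payoff cancels the
  rescaling.\<close>

lemma expected_payoff_separate_delegation:
  assumes \<theta>: "\<theta> \<in> space (type_space n)" and \<theta>': "\<theta>' \<in> space (type_space n)"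
  shows "expected_payoff n (y j) (separate_delegation n A q r \<psi> m) \<theta> \<theta>' =
    - (\<Sum>i=1..n. (q i)\<^sup>2 * quadratic_loss (m (\<psi> i (\<theta>' i))) (y j 1 (\<psi> i (\<theta> i))))"
proof -
  let ?K = "\<lambda>i. component_mechanism A q r \<psi> m i (\<theta>' i)"
  let ?M = "separate_delegation n A q r \<psi> m \<theta>'"
  obtain K where K: "\<And>a. a \<in> A 1 \<Longrightarrow> \<bar>a\<bar> \<le> K" using A1_bounded by blast
  have unit: "\<theta> i \<in> {0..1}" "\<theta>' i \<in> {0..1}" if "i \<in> {1..n}" for i
    using that \<theta> \<theta>' by (auto simp: space_type_space PiE_iff)
  have ps: "prob_space (?K i)" and sets: "sets (?K i) = sets (restrict_space borel (A i))"
    if "i \<in> {1..n}" for i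
    using measurable_space[OF component_mechanism_kernel[OF that], of "\<theta>' i"] unit[OF that]
    by (auto simp: space_prob_algebra space_restrict_space)
  have summand: "integrable ?M (\<lambda>a. ((a i - r i) / q i - y j 1 (\<psi> i (\<theta> i)))\<^sup>2)" (is ?I)
    "(LINT a|?M. ((a i - r i) / q i - y j 1 (\<psi> i (\<theta> i)))\<^sup>2) =
      quadratic_loss (m (\<psi> i (\<theta>' i))) (y j 1 (\<psi> i (\<theta> i)))" (is ?E)
    if i: "i \<in> {1..n}" for i
  proof -
    let ?c = "y j 1 (\<psi> i (\<theta> i))"
    let ?f = "\<lambda>a. ((a - r i) / q i - ?c)\<^sup>2"
    have f: "?f \<in> borel_measurable (restrict_space borel (A i))"
      by (intro measurable_restrict_space1) measurable
    have fK: "?f \<in> borel_measurable (?K i)"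
      using f sets[OF i] by (simp cong: measurable_cong_sets)
    have sp: "space (?K i) = A i"
      using sets_eq_imp_space_eq[OF sets[OF i]] by (simp add: space_restrict_space)
    \<comment> \<open>All factors are probability measures, so a coordinate of the product has
      exactly its own factor as law.\<close>
    have d: "distr ?M (?K i) (\<lambda>a. a i) = ?K i"
      unfolding separate_delegation_def using i ps by (intro distr_PiM_component) auto
    have comp: "(\<lambda>a. a i) \<in> ?M \<rightarrow>\<^sub>M ?K i"
      unfolding separate_delegation_def using i by (rule measurable_component_singleton)
    have "integrable (?K i) ?f"
    proof (rule integrable_bounded[OF ps[OF i] fK])
      fix a assume "a \<in> space (?K i)"
      then have "\<bar>(a - r i) / q i\<bar> \<le> K"
        unfolding sp by (intro K A_unscale[OF i])
      then show "\<bar>?f a\<bar> \<le> (K + \<bar>?c\<bar>)\<^sup>2"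
        by (rule square_diff_bound[OF _ order_refl])
    qed
    then show ?I
      using integrable_distr_eq[OF comp fK] unfolding d by (rule iffD1[rotated])
    have "(LINT a|?M. ?f (a i)) = (LINT a|?K i. ?f a)"
      using integral_distr[OF comp fK] unfolding d by (rule sym)
    also have "\<dots> = (LINT a|m (\<psi> i (\<theta>' i)). ?f (q i * a + r i))"
    proof -
      have "(\<lambda>a. q i * a + r i) \<in> m (\<psi> i (\<theta>' i)) \<rightarrow>\<^sub>M restrict_space borel (A i)"
        using rescale_measurable[OF i] mechanism1_space(2)[OF \<psi>_unit[OF i unit(2)[OF i]]]
        by (simp cong: measurable_cong_sets)
      then show ?thesis
        unfolding component_mechanism_def using f by (rule integral_distr)
    qed
    also have "\<dots> = quadratic_loss (m (\<psi> i (\<theta>' i))) ?c"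
      using q_nonzero[OF i] by (simp add: quadratic_loss_def)
    finally show ?E .
  qed
  show ?thesis
    unfolding expected_payoff_def payoff_rescaled[OF \<theta>] using summand by simp
qed

text \<open>The agent's loss is a nonnegative combination of one-dimensional losses, and truth
  minimises every term separately.\<close>

lemma IC_separate_delegation:
  assumes "m \<in> IC_mechanisms1 (A 1) (y Agent 1)"
  shows "separate_delegation n A q r \<psi> m \<in> IC_mechanisms n A (y Agent)"
proof -
  have "expected_payoff n (y Agent) (separate_delegation n A q r \<psi> m) \<theta> \<theta>' \<le>
      expected_payoff n (y Agent) (separate_delegation n A q r \<psi> m) \<theta> \<theta>"
    if \<theta>: "\<theta> \<in> space (type_space n)" "\<theta>' \<in> space (type_space n)" for \<theta> \<theta>'
  proof -
    have "\<psi> i (\<theta> i) \<in> {0..1}" "\<psi> i (\<theta>' i) \<in> {0..1}" if "i \<in> {1..n}" for i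
      using that \<theta> by (auto simp: space_type_space PiE_iff intro!: \<psi>_unit simp del: atLeastAtMost_iff)
    then show ?thesis
      using \<theta> assms unfolding IC_mechanisms1_iff
      by (auto simp only: expected_payoff_separate_delegation neg_le_iff_le
          intro!: sum_mono mult_left_mono zero_le_power2)
  qed
  then show ?thesis
    using separate_delegation_mechanism by (auto simp: IC_mechanisms_def)
qed

text \<open>Each summand of the truthful payoff depends on a single coordinate, so the prior enters
  only through the laws of \<open>\<psi> i (\<theta> i)\<close>; how the coordinates are correlated
  does not affect the value.\<close>

lemma V_separate_delegation:
  assumes \<mu>: "\<mu> \<in> space (prob_algebra (type_space n))"
  shows "V n (y j) (separate_delegation n A q r \<psi> m) (joint_cdf n \<mu>) =
    (\<Sum>i=1..n. (q i)\<^sup>2 * V1 (y j 1) m (unit_cdf (distr \<mu> unit_borel (\<lambda>\<theta>. \<psi> i (\<theta> i)))))"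
proof -
  interpret prob_space \<mu> using \<mu> by (simp add: space_prob_algebra)
  obtain K where K: "\<And>a. a \<in> A 1 \<Longrightarrow> \<bar>a\<bar> \<le> K" using A1_bounded by blast
  obtain L where L: "\<And>t. t \<in> {0..1} \<Longrightarrow> \<bar>y j 1 t\<bar> \<le> L" using y1_bounded by blast
  have s: "sets \<mu> = sets (type_space n)" using \<mu> by (simp add: space_prob_algebra)
  note sp = sets_eq_imp_space_eq[OF s]
  let ?g = "\<lambda>t. quadratic_loss (m t) (y j 1 t)"
  have g: "?g \<in> borel_measurable unit_borel"
    by (rule borel_measurable_quadratic_loss[OF m[unfolded mechanisms1_def] y1_measurable])
  \<comment> \<open>The constants come from compactness of \<open>A 1\<close> and continuity of
    \<open>y j 1\<close> on the type interval; the bound supplies integrability under every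
    prior.\<close>
  have g_bound: "\<bar>?g t\<bar> \<le> (K + L)\<^sup>2" if "t \<in> {0..1}" for t
    by (rule quadratic_loss_bounded[OF mechanism1_space[OF that] K L[OF that]])
  have proj: "(\<lambda>\<theta>. \<psi> i (\<theta> i)) \<in> \<mu> \<rightarrow>\<^sub>M unit_borel" if i: "i \<in> {1..n}" for i
    using measurable_compose[OF measurable_type_space_component[OF i] \<psi>_measurable[OF i]] s
    by (simp cong: measurable_cong_sets)
  have int: "integrable \<mu> (\<lambda>\<theta>. ?g (\<psi> i (\<theta> i)))" if i: "i \<in> {1..n}" for i
  proof (rule integrable_bounded[OF prob_space_axioms measurable_compose[OF proj[OF i] g]])
    fix \<theta> assume "\<theta> \<in> space \<mu>"
    then have "\<psi> i (\<theta> i) \<in> {0..1}"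
      using measurable_space[OF proj[OF i]] by (simp add: space_restrict_space)
    then show "\<bar>?g (\<psi> i (\<theta> i))\<bar> \<le> (K + L)\<^sup>2" by (rule g_bound)
  qed
  have "V n (y j) (separate_delegation n A q r \<psi> m) (joint_cdf n \<mu>) =
      (LINT \<theta>|\<mu>. - (\<Sum>i=1..n. (q i)\<^sup>2 * ?g (\<psi> i (\<theta> i))))"
    unfolding V_joint_cdf[OF \<mu>] using sp
    by (intro Bochner_Integration.integral_cong) (auto simp: expected_payoff_separate_delegation)
  also have "\<dots> = (\<Sum>i=1..n. (q i)\<^sup>2 * - (LINT \<theta>|\<mu>. ?g (\<psi> i (\<theta> i))))"
    using int by (simp add: sum_negf)
  also have "\<dots> = (\<Sum>i=1..n. (q i)\<^sup>2 * V1 (y j 1) m (unit_cdf (distr \<mu> unit_borel (\<lambda>\<theta>. \<psi> i (\<theta> i)))))"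
  proof (intro sum.cong refl arg_cong2[where f="(*)"])
    fix i assume i: "i \<in> {1..n}"
    have "distr \<mu> unit_borel (\<lambda>\<theta>. \<psi> i (\<theta> i)) \<in> space (prob_algebra unit_borel)"
      using prob_space_distr[OF proj[OF i]] by (simp add: space_prob_algebra)
    then show "- (LINT \<theta>|\<mu>. ?g (\<psi> i (\<theta> i))) =
        V1 (y j 1) m (unit_cdf (distr \<mu> unit_borel (\<lambda>\<theta>. \<psi> i (\<theta> i))))"
      by (simp only: V1_unit_cdf integral_distr[OF proj[OF i] g])
  qed
  finally show ?thesis .
qed

text \<open>The law of each \<open>\<psi> i (\<theta> i)\<close> is itself an admissible
  one-dimensional prior, so the guarantee \<open>v\<close> applies term by term with weight
  \<open>(q i)\<^sup>2\<close>.\<close>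

lemma V_separate_delegation_ge:
  assumes F: "F \<in> CDFs n" and v: "\<And>G. G \<in> CDFs1 \<Longrightarrow> v \<le> V1 (y j 1) m G"
  shows "(\<Sum>i=1..n. (q i)\<^sup>2) * v \<le> V n (y j) (separate_delegation n A q r \<psi> m) F"
proof -
  obtain \<mu> where \<mu>: "\<mu> \<in> space (prob_algebra (type_space n))" and F_eq: "F = joint_cdf n \<mu>"
    using F by (auto simp: CDFs_def)
  interpret prob_space \<mu> using \<mu> by (simp add: space_prob_algebra)
  have "unit_cdf (distr \<mu> unit_borel (\<lambda>\<theta>. \<psi> i (\<theta> i))) \<in> CDFs1" if i: "i \<in> {1..n}" for i
  proof -
    have "(\<lambda>\<theta>. \<psi> i (\<theta> i)) \<in> \<mu> \<rightarrow>\<^sub>M unit_borel"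
      using measurable_compose[OF measurable_type_space_component[OF i] \<psi>_measurable[OF i]] \<mu>
      by (simp add: space_prob_algebra cong: measurable_cong_sets)
    then show ?thesis
      using prob_space_distr unfolding CDFs1_eq by (intro imageI) (simp add: space_prob_algebra)
  qed
  then show ?thesis
    unfolding F_eq V_separate_delegation[OF \<mu>] sum_distrib_right
    by (intro sum_mono mult_left_mono v) auto
qed

end

section \<open>Priors carried by the curve\<close>

definition curve_distr :: "real measure \<Rightarrow> (nat \<Rightarrow> real) measure" where
  "curve_distr \<nu> = distr \<nu> (type_space n) curve"

context
  fixes \<nu> assumes \<nu>: "\<nu> \<in> space (prob_algebra unit_borel)"
begin

lemma curve_measurable': "curve \<in> \<nu> \<rightarrow>\<^sub>M type_space n"
  using curve_measurable \<nu> by (simp add: space_prob_algebra cong: measurable_cong_sets)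

lemma space_\<nu>: "space \<nu> = {0..1}"
  using \<nu> sets_eq_imp_space_eq[of \<nu> unit_borel] by (simp add: space_prob_algebra space_restrict_space)

lemma curve_distr_space: "curve_distr \<nu> \<in> space (prob_algebra (type_space n))"
  using \<nu> prob_space.prob_space_distr[OF _ curve_measurable']
  by (simp add: space_prob_algebra curve_distr_def)

text \<open>\<open>curve t\<close> lies in the orthant below \<open>\<theta>\<close> exactly when
  every \<open>\<phi> i t \<le> \<theta> i\<close>, and for \<open>i = 1\<close> this reads
  \<open>t \<le> \<theta> 1\<close> because \<open>\<phi> 1\<close> is the identity on the type
  interval. So the coupled CDF has a genuine distribution behind it.\<close>

lemma joint_cdf_curve_distr: "joint_cdf n (curve_distr \<nu>) = coupled_CDF n \<psi> (unit_cdf \<nu>)"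
proof
  fix \<theta>
  interpret prob_space \<nu> using \<nu> by (simp add: space_prob_algebra)
  let ?O = "{x \<in> space (type_space n). \<forall>i\<in>{1..n}. x i \<le> \<theta> i}"
  let ?S = "{s. s \<le> \<theta> 1 \<and> (\<forall>i\<in>{2..n}. inv_into {0..1} (\<psi> i) s \<le> \<theta> i)}"
  have O: "?O \<in> sets (type_space n)"
    unfolding sets_type_space_orthants by (rule sigma_sets.Basic) (rule rangeI)
  have split: "{1..n} = insert 1 {2..n}" using n by auto
  \<comment> \<open>The comparison is made inside \<open>space \<nu>\<close>, since
    \<open>inv_into\<close> has no meaningful value off the image of
    \<open>\<psi> i\<close>.\<close>
  have eq: "curve -` ?O \<inter> space \<nu> = ?S \<inter> space \<nu>"
  proof -
    have "curve t \<in> ?O \<longleftrightarrow> t \<in> ?S" if "t \<in> {0..1}" for t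
      using curve_space[OF that] \<phi>_1[OF that] n unfolding split
      by (simp add: curve_def \<phi>_def)
    then show ?thesis unfolding space_\<nu> by blast
  qed
  have meas: "?S \<inter> space \<nu> \<in> sets \<nu>"
    using measurable_sets[OF curve_measurable' O] eq by simp
  have "joint_cdf n (curve_distr \<nu>) \<theta> = measure \<nu> (?S \<inter> space \<nu>)"
    unfolding joint_cdf_def curve_distr_def using O eq curve_measurable'
    by (simp add: measure_distr)
  also have "\<dots> = (LINT t|\<nu>. indicat_real ?S t)"
    using meas by simp
  also have "\<dots> = coupled_CDF n \<psi> (unit_cdf \<nu>) \<theta>"
    unfolding coupled_CDF_def by (rule set_integral_unit_cdf[OF \<nu>, symmetric])
  finally show "joint_cdf n (curve_distr \<nu>) \<theta> = coupled_CDF n \<psi> (unit_cdf \<nu>) \<theta>" .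
qed

text \<open>Along the curve each \<open>\<psi> i (\<theta> i)\<close> returns the common parameter,
  so every law in \<open>V_separate_delegation\<close> is \<open>\<nu>\<close> and the weighted sum
  collapses.\<close>

lemma V_separate_delegation_curve:
  assumes m: "m \<in> mechanisms1 (A 1)"
  shows "V n (y j) (separate_delegation n A q r \<psi> m) (joint_cdf n (curve_distr \<nu>)) =
    (\<Sum>i=1..n. (q i)\<^sup>2) * V1 (y j 1) m (unit_cdf \<nu>)"
proof -
  have "distr (curve_distr \<nu>) unit_borel (\<lambda>\<theta>. \<psi> i (\<theta> i)) = \<nu>" if i: "i \<in> {1..n}" for i
  proof -
    have "distr (curve_distr \<nu>) unit_borel (\<lambda>\<theta>. \<psi> i (\<theta> i)) =
        distr \<nu> unit_borel ((\<lambda>\<theta>. \<psi> i (\<theta> i)) \<circ> curve)"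
      unfolding curve_distr_def
      by (rule distr_distr[OF measurable_compose[OF measurable_type_space_component[OF i]
              \<psi>_measurable[OF i]] curve_measurable'])
    also have "\<dots> = distr \<nu> unit_borel (\<lambda>t. t)"
      using i by (intro distr_cong) (auto simp: space_\<nu> curve_def \<psi>_\<phi>)
    also have "\<dots> = \<nu>"
      using \<nu> by (intro distr_id2) (simp add: space_prob_algebra)
    finally show ?thesis .
  qed
  then have "(\<Sum>i=1..n. (q i)\<^sup>2 *
      V1 (y j 1) m (unit_cdf (distr (curve_distr \<nu>) unit_borel (\<lambda>\<theta>. \<psi> i (\<theta> i))))) =
    (\<Sum>i=1..n. (q i)\<^sup>2 * V1 (y j 1) m (unit_cdf \<nu>))"
    by (intro sum.cong refl) (simp only:)
  then show ?thesis
    by (simp only: V_separate_delegation[OF m curve_distr_space] sum_distrib_right)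
qed

end

section \<open>Averaging a mechanism over the coordinates\<close>

lemma weight_sum_pos: "0 < (\<Sum>i=1..n. (q i)\<^sup>2)"
  using n q_nonzero by (intro sum_pos) auto

definition index_distr :: "nat measure" where
  "index_distr = density (count_space {1..n}) (\<lambda>i. ennreal ((q i)\<^sup>2 / (\<Sum>k=1..n. (q k)\<^sup>2)))"

lemma index_distr_prob: "index_distr \<in> space (prob_algebra (count_space {1..n}))"
proof -
  have "emeasure index_distr {1..n} = (\<Sum>i=1..n. ennreal ((q i)\<^sup>2 / (\<Sum>k=1..n. (q k)\<^sup>2)))"
    unfolding index_distr_def by (simp add: emeasure_density nn_integral_count_space_finite)
  also have "\<dots> = ennreal ((\<Sum>i=1..n. (q i)\<^sup>2) / (\<Sum>k=1..n. (q k)\<^sup>2))"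
    unfolding sum_divide_distrib by (rule sum_ennreal) (simp add: sum_nonneg)
  also have "\<dots> = 1" by (simp only: divide_self[OF less_imp_neq[OF weight_sum_pos, symmetric]] ennreal_1)
  finally have "emeasure index_distr (space index_distr) = 1"
    by (simp add: index_distr_def)
  then show ?thesis
    by (auto simp: space_prob_algebra index_distr_def intro: prob_spaceI)
qed

lemma integral_index_distr:
  fixes f :: "nat \<Rightarrow> real"
  shows "(LINT i|index_distr. f i) = (\<Sum>i=1..n. (q i)\<^sup>2 * f i) / (\<Sum>k=1..n. (q k)\<^sup>2)"
  unfolding index_distr_def using weight_sum_pos
  by (subst integral_density)
    (auto simp: lebesgue_integral_count_space_finite sum_divide_distrib intro!: divide_nonneg_nonneg sum_nonneg)

definition random_coordinate :: "(nat \<Rightarrow> real) \<Rightarrow> real measure" where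
  "random_coordinate a =
    distr index_distr (restrict_space borel (A 1)) (\<lambda>i. (a i - r i) / q i)"

lemma measurable_unscaled_coordinate:
  "i \<in> {1..n} \<Longrightarrow> (\<lambda>a. (a i - r i) / q i) \<in> action_space n A \<rightarrow>\<^sub>M restrict_space borel (A 1)"
  unfolding action_space_def
  by (rule measurable_compose[OF _ unscale_measurable]) (rule measurable_component_singleton)

lemma random_coordinate_kernel:
  "random_coordinate \<in> action_space n A \<rightarrow>\<^sub>M prob_algebra (restrict_space borel (A 1))"
  unfolding random_coordinate_def[abs_def]
proof (rule measurable_distr_prob_space2)
  show "(\<lambda>_. index_distr) \<in> action_space n A \<rightarrow>\<^sub>M prob_algebra (count_space {1..n})"
    using index_distr_prob by simp
  \<comment> \<open>The index set is countable, so joint measurability follows from measurability in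
    \<open>a\<close> for each fixed \<open>i\<close>.\<close>
  have "(\<lambda>(i, a). (a i - r i) / q i) \<in>
      count_space {1..n} \<Otimes>\<^sub>M action_space n A \<rightarrow>\<^sub>M restrict_space borel (A 1)"
    using measurable_unscaled_coordinate by (intro measurable_pair_measure_countable1) auto
  from measurable_compose[OF measurable_pair_swap' this]
  show "(\<lambda>(a, i). (a i - r i) / q i) \<in>
      action_space n A \<Otimes>\<^sub>M count_space {1..n} \<rightarrow>\<^sub>M restrict_space borel (A 1)"
    by (simp add: case_prod_beta')
qed

text \<open>The sampling weights are the factors of \<open>payoff_rescaled\<close>, normalised. The
  random coordinate therefore reproduces the multidimensional loss, up to the total weight, whenever
  all unscaled bliss points equal \<open>c\<close>.\<close>

lemma quadratic_loss_random_coordinate: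
  assumes a: "a \<in> space (action_space n A)"
  shows "quadratic_loss (random_coordinate a) c =
    (\<Sum>i=1..n. (q i)\<^sup>2 * ((a i - r i) / q i - c)\<^sup>2) / (\<Sum>k=1..n. (q k)\<^sup>2)"
proof -
  have "(\<lambda>i. (a i - r i) / q i) \<in> index_distr \<rightarrow>\<^sub>M restrict_space borel (A 1)"
    using measurable_space[OF measurable_unscaled_coordinate a] unfolding index_distr_def by auto
  moreover have "(\<lambda>b. (b - c)\<^sup>2) \<in> borel_measurable (restrict_space borel (A 1))"
    by (intro measurable_restrict_space1) measurable
  ultimately show ?thesis
    unfolding quadratic_loss_def random_coordinate_def
    by (simp only: integral_distr integral_index_distr)
qed

text \<open>Needed for an arbitrary mechanism: its truthful payoff must be measurable in the type
  before its integral can be transported along \<open>curve\<close>.\<close>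

lemma measurable_payoff:
  "(\<lambda>(\<theta>, a). payoff n (y j) a \<theta>) \<in> borel_measurable (type_space n \<Otimes>\<^sub>M action_space n A)"
proof -
  have a: "(\<lambda>x. snd x i) \<in> borel_measurable (type_space n \<Otimes>\<^sub>M action_space n A)" if i: "i \<in> {1..n}" for i
  proof -
    have "(\<lambda>a. a) \<in> borel_measurable (restrict_space borel (A i))"
      by (rule measurable_restrict_space1) simp
    from measurable_compose[OF measurable_component_singleton[OF i, of "\<lambda>i. restrict_space borel (A i)"] this]
    show ?thesis
      unfolding action_space_def by (rule measurable_compose[OF measurable_snd])
  qed
  have b: "(\<lambda>x. y j i (fst x i)) \<in> borel_measurable (type_space n \<Otimes>\<^sub>M action_space n A)"
    if i: "i \<in> {1..n}" for i
  proof -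
    have "(\<lambda>t. q i * y j 1 (\<psi> i t) + r i) \<in> borel_measurable unit_borel"
      using measurable_compose[OF \<psi>_measurable[OF i] y1_measurable[of j]] by measurable
    then have "y j i \<in> borel_measurable unit_borel"
      using y_eq[OF i] by (subst measurable_cong) (auto simp: space_restrict_space)
    from measurable_compose[OF measurable_type_space_component[OF i] this]
    show ?thesis by (rule measurable_compose[OF measurable_fst])
  qed
  show ?thesis
    unfolding payoff_def case_prod_beta'
    by (intro borel_measurable_uminus borel_measurable_sum borel_measurable_power borel_measurable_diff a b)
qed

text \<open>On the curve \<open>\<psi> i (curve t i) = t\<close> for all \<open>i\<close>, so the
  unscaled bliss points coincide in \<open>y j 1 t\<close> and the loss of the random coordinate
  applies. One and the same \<open>m\<close> serves both players, all true types and all reports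
  along the curve.\<close>

lemma averaged_mechanism:
  assumes M: "M \<in> mechanisms n A"
  obtains m where "m \<in> mechanisms1 (A 1)"
    and "\<And>j t t'. t \<in> {0..1} \<Longrightarrow> t' \<in> {0..1} \<Longrightarrow> expected_payoff n (y j) M (curve t) (curve t') =
      - ((\<Sum>i=1..n. (q i)\<^sup>2) * quadratic_loss (m t') (y j 1 t))"
proof
  let ?Q = "\<Sum>i=1..n. (q i)\<^sup>2"
  \<comment> \<open>Two-stage lottery: the report \<open>t\<close> is embedded in the curve,
    \<open>M\<close> draws an action profile, then one unscaled coordinate of it is drawn.\<close>
  let ?m = "\<lambda>t. M (curve t) \<bind> random_coordinate"
  have M': "M \<in> type_space n \<rightarrow>\<^sub>M prob_algebra (action_space n A)"
    using M by (simp add: mechanisms_def)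
  show "?m \<in> mechanisms1 (A 1)"
    unfolding mechanisms1_def
    by (rule measurable_bind_prob_space[OF measurable_compose[OF curve_measurable M'] random_coordinate_kernel])
  fix j t t' assume t: "t \<in> {0..1::real}" and t': "t' \<in> {0..1::real}"
  let ?c = "y j 1 t"
  obtain K where K: "\<And>a. a \<in> A 1 \<Longrightarrow> \<bar>a\<bar> \<le> K" using A1_bounded by blast
  have "M (curve t') \<in> space (prob_algebra (action_space n A))"
    by (rule measurable_space[OF M' curve_space[OF t']])
  then have sets: "sets (M (curve t')) = sets (action_space n A)" and ps: "prob_space (M (curve t'))"
    by (simp_all add: space_prob_algebra)
  interpret prob_space "M (curve t')" by fact
  note sp = sets_eq_imp_space_eq[OF sets]
  have kernel: "random_coordinate \<in> M (curve t') \<rightarrow>\<^sub>M prob_algebra (restrict_space borel (A 1))"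
    using random_coordinate_kernel by (simp only: measurable_cong_sets[OF sets refl])
  have "quadratic_loss (?m t') ?c = (LINT a|M (curve t'). quadratic_loss (random_coordinate a) ?c)"
    unfolding quadratic_loss_def
  \<comment> \<open>Integration can be iterated over the two stages because the squares are bounded
    on \<open>A 1\<close> and each second-stage lottery has mass 1.\<close>
  proof (rule integral_bind[OF _ _ measurable_prob_algebraD[OF kernel] finite_measure_axioms])
    show "(\<lambda>a. (a - ?c)\<^sup>2) \<in> borel_measurable (restrict_space borel (A 1))"
      by (intro measurable_restrict_space1) measurable
    show "\<bar>(a - ?c)\<^sup>2\<bar> \<le> (K + \<bar>?c\<bar>)\<^sup>2" if "a \<in> space (restrict_space borel (A 1))" for a
      using that by (intro square_diff_bound K) (auto simp: space_restrict_space)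
    have "emeasure (random_coordinate a) (space (random_coordinate a)) \<le> ennreal 1"
      if "a \<in> space (M (curve t'))" for a
      using measurable_space[OF kernel that] by (simp add: space_prob_algebra prob_space.emeasure_space_1)
    then show "AE a in M (curve t'). emeasure (random_coordinate a) (space (random_coordinate a)) \<le> ennreal 1"
      by (rule AE_I2)
  qed
  also have "\<dots> = (LINT a|M (curve t'). - payoff n (y j) a (curve t) / ?Q)"
  proof (intro Bochner_Integration.integral_cong refl)
    fix a assume "a \<in> space (M (curve t'))"
    then have a: "a \<in> space (action_space n A)" by (simp only: sp)
    have "(\<Sum>i=1..n. (q i)\<^sup>2 * ((a i - r i) / q i - ?c)\<^sup>2) = - payoff n (y j) a (curve t)"
      unfolding payoff_rescaled[OF curve_space[OF t]] minus_minus
      using \<psi>_\<phi> t by (intro sum.cong refl) (auto simp: curve_def)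
    then show "quadratic_loss (random_coordinate a) ?c = - payoff n (y j) a (curve t) / ?Q"
      by (simp only: quadratic_loss_random_coordinate[OF a])
  qed
  also have "\<dots> = - expected_payoff n (y j) M (curve t) (curve t') / ?Q"
    unfolding expected_payoff_def by (simp only: integral_divide_zero integral_minus)
  finally show "expected_payoff n (y j) M (curve t) (curve t') = - (?Q * quadratic_loss (?m t') ?c)"
    using weight_sum_pos by (simp add: field_simps)
qed

text \<open>A prior on the curve sees only truthful payoffs there, which are those of the averaged
  mechanism times the total weight. Since that mechanism is incentive compatible, the
  one-dimensional bound \<open>v\<close> carries over.\<close>

lemma V_curve_le:
  assumes \<nu>: "\<nu> \<in> space (prob_algebra unit_borel)"
    and M: "M \<in> IC_mechanisms n A (y Agent)"
    and v: "\<And>m. m \<in> IC_mechanisms1 (A 1) (y Agent 1) \<Longrightarrow> V1 (y j 1) m (unit_cdf \<nu>) \<le> v"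
  shows "V n (y j) M (joint_cdf n (curve_distr \<nu>)) \<le> (\<Sum>i=1..n. (q i)\<^sup>2) * v"
proof -
  let ?Q = "\<Sum>i=1..n. (q i)\<^sup>2"
  have M': "M \<in> mechanisms n A" using M by (simp add: IC_mechanisms_def)
  obtain m where m: "m \<in> mechanisms1 (A 1)"
    and m_payoff: "\<And>j t t'. t \<in> {0..1} \<Longrightarrow> t' \<in> {0..1} \<Longrightarrow>
      expected_payoff n (y j) M (curve t) (curve t') = - (?Q * quadratic_loss (m t') (y j 1 t))"
    using averaged_mechanism[OF M'] by blast
  have "m \<in> IC_mechanisms1 (A 1) (y Agent 1)"
    unfolding IC_mechanisms1_iff
  proof (intro conjI ballI m)
    \<comment> \<open>A one-dimensional misreport \<open>t'\<close> corresponds to misreporting the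
      profile \<open>curve t'\<close>, a deviation that \<open>M\<close> deters.\<close>
    fix t t' assume t: "t \<in> {0..1::real}" "t' \<in> {0..1::real}"
    have "expected_payoff n (y Agent) M (curve t) (curve t') \<le> expected_payoff n (y Agent) M (curve t) (curve t)"
      using M curve_space t by (auto simp: IC_mechanisms_def)
    then show "quadratic_loss (m t) (y Agent 1 t) \<le> quadratic_loss (m t') (y Agent 1 t)"
      using weight_sum_pos by (simp only: m_payoff t neg_le_iff_le mult_le_cancel_left_pos)
  qed
  then have le: "V1 (y j 1) m (unit_cdf \<nu>) \<le> v" by (rule v)
  have meas: "(\<lambda>\<theta>. expected_payoff n (y j) M \<theta> \<theta>) \<in> borel_measurable (type_space n)"
    unfolding expected_payoff_def
    by (rule borel_measurable_integral_kernel[OF measurable_payoff M'[unfolded mechanisms_def]])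
  have "V n (y j) M (joint_cdf n (curve_distr \<nu>)) =
      (LINT t|\<nu>. expected_payoff n (y j) M (curve t) (curve t))"
    unfolding V_joint_cdf[OF curve_distr_space[OF \<nu>]] unfolding curve_distr_def
    by (rule integral_distr[OF curve_measurable'[OF \<nu>] meas])
  also have "\<dots> = (LINT t|\<nu>. - (?Q * quadratic_loss (m t) (y j 1 t)))"
    by (intro Bochner_Integration.integral_cong refl m_payoff) (simp_all only: space_\<nu>[OF \<nu>])
  also have "\<dots> = ?Q * V1 (y j 1) m (unit_cdf \<nu>)"
    unfolding V1_unit_cdf[OF \<nu>] by simp
  also have "\<dots> \<le> ?Q * v"
    using le weight_sum_pos by (intro mult_left_mono) auto
  finally show ?thesis .
qed

end

section \<open>Transfer of the saddle point and robust optimality\<close>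

theorem mainTheorem4:
  fixes n :: nat
    and A :: "nat \<Rightarrow> real set"
    and y :: "player \<Rightarrow> nat \<Rightarrow> real \<Rightarrow> real"
    and q r :: "nat \<Rightarrow> real"
    and \<psi> :: "nat \<Rightarrow> real \<Rightarrow> real"
    and m1 :: "real \<Rightarrow> real measure"
    and F1 :: "real \<Rightarrow> real"
  assumes n: "n \<ge> 1"
    and A1: "compact (A 1)" "is_interval (A 1)"
    and y1_range: "\<And>j. y j 1 ` {0..1} \<subseteq> A 1"
    and y1_C1: "\<And>j. C1_on {0..1} (y j 1)"
    and y1_mono: "\<And>j. strict_mono_on {0..1} (y j 1)"
    and bias_mono: "mono_on {0..1} (\<lambda>t. y Agent 1 t - y Principal 1 t) \<or>
                    antimono_on {0..1} (\<lambda>t. y Agent 1 t - y Principal 1 t)"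
    and bias_zero: "\<And>s t. s \<in> {0..1} \<Longrightarrow> t \<in> {0..1} \<Longrightarrow>
                      y Agent 1 s - y Principal 1 s = 0 \<Longrightarrow> y Agent 1 t - y Principal 1 t = 0 \<Longrightarrow> s = t"
    and y: "\<And>i j t. i \<in> {1..n} \<Longrightarrow> t \<in> {0..1} \<Longrightarrow> y j i t = q i * y j 1 (\<psi> i t) + r i"
    and \<psi>: "\<And>i. i \<in> {1..n} \<Longrightarrow> C1_diffeomorphism {0..1} {0..1} (\<psi> i)"
    and q_\<psi>: "\<And>i t. i \<in> {1..n} \<Longrightarrow> t \<in> {0..1} \<Longrightarrow> q i * deriv_within (\<psi> i) {0..1} t > 0"
    and A: "\<And>i. i \<in> {1..n} \<Longrightarrow> A i = (\<lambda>a. q i * a + r i) ` A 1"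
    and normalized: "q 1 = 1" "r 1 = 0" "\<And>t. t \<in> {0..1} \<Longrightarrow> \<psi> 1 t = t"
    and saddle1: "saddle_point1 (A 1) (y Agent 1) (y Principal 1) m1 F1"
  defines "\<M> \<equiv> IC_mechanisms n A (y Agent)"
    and "M\<^sub>s \<equiv> separate_delegation n A q r \<psi> m1"
    and "F\<^sub>s \<equiv> coupled_CDF n \<psi> F1"
  shows "M\<^sub>s \<in> \<M> \<and> F\<^sub>s \<in> CDFs n \<and>
    (\<forall>F\<in>CDFs n. V n (y Principal) M\<^sub>s F \<ge> V n (y Principal) M\<^sub>s F\<^sub>s) \<and>
    (\<forall>M\<in>\<M>. V n (y Principal) M\<^sub>s F\<^sub>s \<ge> V n (y Principal) M F\<^sub>s) \<and>
    (INF F\<in>CDFs n. ereal (V n (y Principal) M\<^sub>s F)) =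
      (SUP M\<in>\<M>. INF F\<in>CDFs n. ereal (V n (y Principal) M F))"
proof -
  have C1_cont: "continuous_on S f" if "C1_on S f" for S f
    using that by (simp add: C1_on_def differentiable_imp_continuous_on)
  \<comment> \<open>Positivity of the product at a single point, here 0, excludes a zero
    factor.\<close>
  have q_nonzero: "q i \<noteq> 0" if "i \<in> {1..n}" for i
    using q_\<psi>[OF that, of 0] by auto
  have \<psi>_parts: "bij_betw (\<psi> i) {0..1} {0..1}" "continuous_on {0..1} (\<psi> i)"
    "continuous_on {0..1} (inv_into {0..1} (\<psi> i))" if "i \<in> {1..n}" for i
    using \<psi>[OF that] C1_cont by (auto simp: C1_diffeomorphism_def)
  interpret rescaled_copies n A y q r \<psi>
    by (rule rescaled_copies.intro; fact n A1(1) C1_cont[OF y1_C1] y \<psi>_parts q_nonzero A normalized(3))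
  have m1_IC: "m1 \<in> IC_mechanisms1 (A 1) (y Agent 1)" and "F1 \<in> CDFs1"
    and F1_min: "\<And>F. F \<in> CDFs1 \<Longrightarrow> V1 (y Principal 1) m1 F1 \<le> V1 (y Principal 1) m1 F"
    and m1_max: "\<And>m. m \<in> IC_mechanisms1 (A 1) (y Agent 1) \<Longrightarrow>
      V1 (y Principal 1) m F1 \<le> V1 (y Principal 1) m1 F1"
    using saddle1 by (auto simp: saddle_point1_def)
  then have m1: "m1 \<in> mechanisms1 (A 1)" by (simp add: IC_mechanisms1_iff)
  obtain \<nu> where \<nu>: "\<nu> \<in> space (prob_algebra unit_borel)" and F1: "F1 = unit_cdf \<nu>"
    using \<open>F1 \<in> CDFs1\<close> unfolding CDFs1_eq by blast
  have Fs: "F\<^sub>s = joint_cdf n (curve_distr \<nu>)"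
    unfolding F\<^sub>s_def F1 by (rule joint_cdf_curve_distr[OF \<nu>, symmetric])
  have Ms_IC: "M\<^sub>s \<in> \<M>"
    unfolding M\<^sub>s_def \<M>_def by (rule IC_separate_delegation[OF m1 m1_IC])
  have Fs_CDF: "F\<^sub>s \<in> CDFs n"
    unfolding Fs CDFs_def by (rule imageI[OF curve_distr_space[OF \<nu>]])
  have V_saddle: "V n (y Principal) M\<^sub>s F\<^sub>s = (\<Sum>i=1..n. (q i)\<^sup>2) * V1 (y Principal 1) m1 F1"
    unfolding M\<^sub>s_def Fs F1 by (rule V_separate_delegation_curve[OF \<nu> m1])
  have F_min: "V n (y Principal) M\<^sub>s F\<^sub>s \<le> V n (y Principal) M\<^sub>s F" if "F \<in> CDFs n" for F
    unfolding V_saddle unfolding M\<^sub>s_def by (rule V_separate_delegation_ge[OF m1 that F1_min])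
  have M_max: "V n (y Principal) M F\<^sub>s \<le> V n (y Principal) M\<^sub>s F\<^sub>s" if "M \<in> \<M>" for M
    unfolding V_saddle unfolding Fs
    by (rule V_curve_le[OF \<nu> that[unfolded \<M>_def]]) (simp only: F1[symmetric] m1_max)
  \<comment> \<open>The saddle inequalities chain: the guarantee of \<open>M\<close> is at most its
    value at \<open>F\<^sub>s\<close>, hence at most the saddle value, which bounds
    \<open>M\<^sub>s\<close> from below at every prior. The reverse inequality between infimum and
    supremum holds because \<open>M\<^sub>s\<close> is itself a competitor.\<close>
  have "(INF F\<in>CDFs n. ereal (V n (y Principal) M F)) \<le> (INF F\<in>CDFs n. ereal (V n (y Principal) M\<^sub>s F))"
    if "M \<in> \<M>" for M
  proof (rule order_trans[OF INF_lower[OF Fs_CDF] INF_greatest])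
    fix F assume "F \<in> CDFs n"
    then show "ereal (V n (y Principal) M F\<^sub>s) \<le> ereal (V n (y Principal) M\<^sub>s F)"
      using M_max[OF that] F_min by (simp add: order_trans)
  qed
  then have "(INF F\<in>CDFs n. ereal (V n (y Principal) M\<^sub>s F)) =
      (SUP M\<in>\<M>. INF F\<in>CDFs n. ereal (V n (y Principal) M F))"
    by (intro antisym SUP_upper2[OF Ms_IC] SUP_least) auto
  then show ?thesis using Ms_IC Fs_CDF F_min M_max by blast
qed

end
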